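(* For a positive integer $n$, let $\nu_2(n)$ denote the $2$-adic order of $n$ and let $N_n=n(1+\nu_2(n)/2)$. Then for all positive integers $k$, $$(-1)^k\left(1-\frac{1}{(q;q)_{\infty}}\sum_{j=1-k}^k(-1)^jq^{j(3j-1)/2}\right)\prod_{n=1}^{\infty}(1-q^{N_{2n}})\in\mathbb{N}[[q]],$$ and $$(-1)^{k-1}\left(1-\frac{1}{(q;q)_{\infty}}\sum_{j=-k}^k(-1)^jq^{j(3j-1)/2}\right)\prod_{n=1}^{\infty}(1-q^{N_{2n}})\in\mathbb{N}[[q]].$$
   Context: $(q;q)_\infty=\prod_{m=1}^\infty(1-q^m)$ as a formal power series in $q$. $\mathbb{N}[[q]]$ is the set of formal power series in $q$ with nonnegative integer coefficients. The $2$-adic order $\nu_2(n)$ is the exponent of the largest power of $2$ dividing $n$. *)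

theory Defs
  imports "HOL-Analysis.Analysis"
begin

text \<open>
  The coefficient ring is taken to be the reals, so that the library's division of formal power
  series and its infinite products (with respect to the \<open>fps_X\<close>-adic metric) are available.
  Products over positive indices are written with a shift, since \<^const>\<open>prodinf\<close> starts at \<open>0\<close>.
\<close>

definition euler_prod :: "real fps" where
  "euler_prod = (\<Prod>m. 1 - fps_X ^ Suc m)"

definition nat_fps :: "real fps set" where
  "nat_fps = {f. \<forall>n. fps_nth f n \<in> \<nat>}"

definition N :: "nat \<Rightarrow> nat" where
  "N n = n * (2 + multiplicity 2 n) div 2"

text \<open>The division in \<^const>\<open>N\<close> is exact: an odd \<open>n\<close> has multiplicity \<open>0\<close>.\<close>

lemma of_nat_N: "real (N n) = real n * (1 + real (multiplicity 2 n) / 2)"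
proof -
  have "even (n * (2 + multiplicity 2 n))"
    by (cases "even n") (auto simp: not_dvd_imp_multiplicity_0)
  then have "real (N n) = real (n * (2 + multiplicity 2 n)) / 2"
    unfolding N_def using real_of_nat_div[of 2 "n * (2 + multiplicity 2 n)"] by simp
  then show ?thesis
    by (simp add: field_simps)
qed

definition even_N_prod :: "real fps" where
  "even_N_prod = (\<Prod>n. 1 - fps_X ^ N (2 * Suc n))"

text \<open>The exponent is a nonnegative integer for every integer \<open>j\<close> and the division is exact.\<close>

definition pentagonal :: "int \<Rightarrow> nat" where
  "pentagonal j = nat (j * (3 * j - 1) div 2)"

lemma of_nat_pentagonal: "real (pentagonal j) = of_int j * (3 * of_int j - 1) / 2"
proof -
  have nonneg: "0 \<le> j * (3 * j - 1)"
    by (cases "j \<ge> 1") (auto simp: zero_le_mult_iff)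
  have ev: "even (j * (3 * j - 1))"
    by simp
  have "real (pentagonal j) = real_of_int (j * (3 * j - 1) div 2)"
    using nonneg by (simp add: pentagonal_def)
  also have "\<dots> = real_of_int (j * (3 * j - 1)) / 2"
    using real_of_int_div[OF ev] by simp
  finally show ?thesis
    by simp
qed

definition pentagonal_sum :: "int \<Rightarrow> int \<Rightarrow> real fps" where
  "pentagonal_sum a b = (\<Sum>j=a..b. fps_const ((-1) powi j) * fps_X ^ pentagonal j)"

lemma has_prod_one_minus_fps_X_power:
  fixes e :: "nat \<Rightarrow> nat"
  assumes e: "\<And>n. n < e n"
  shows "(\<lambda>n. 1 - fps_X ^ e n :: real fps) has_prod (\<Prod>n. 1 - fps_X ^ e n)"
proof -
  let ?f = "\<lambda>n. 1 - fps_X ^ e n :: real fps"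
  have e0: "e n \<noteq> 0" for n
    using e[of n] by simp
  have f0: "fps_nth (?f n) 0 = 1" for n
    using e0[of n] by simp
  have nz: "?f n \<noteq> 0" for n
    using f0[of n] by (metis fps_zero_nth zero_neq_one)
  have sub: "subdegree (?f k - 1) > n" if "k > n" for n k
  proof -
    have "subdegree (?f k - 1) = e k"
      by (simp add: fps_X_power_subdegree)
    with e[of k] that show ?thesis
      by simp
  qed
  obtain P where P: "(\<lambda>n. \<Prod>k\<le>n. ?f k) \<longlonglongrightarrow> P"
    using tendsto_prod_fps[of ?f "\<lambda>n. n"] nz sub by blast
  have prod0: "fps_nth (prod ?f A) 0 = 1" if "finite A" for A
    using that by induction (simp_all add: e0)
  have "\<forall>\<^sub>F n in sequentially. fps_nth (\<Prod>k\<le>n. ?f k) 0 = fps_nth P 0"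
    using P by (simp add: tendsto_fps_iff)
  then have "fps_nth P 0 = 1"
    by (auto simp: prod0 eventually_sequentially)
  then have "P \<noteq> 0"
    by (metis fps_zero_nth zero_neq_one)
  with P have "?f has_prod P"
    by (simp add: has_prod_def raw_has_prod_def)
  with has_prod_unique[OF this] show ?thesis
    by simp
qed

lemma has_prod_euler_prod: "(\<lambda>m. 1 - fps_X ^ Suc m) has_prod euler_prod"
  unfolding euler_prod_def by (rule has_prod_one_minus_fps_X_power) simp

lemma has_prod_even_N_prod: "(\<lambda>n. 1 - fps_X ^ N (2 * Suc n)) has_prod even_N_prod"
  unfolding even_N_prod_def
proof (rule has_prod_one_minus_fps_X_power)
  fix n
  have "N (2 * Suc n) = Suc n * (2 + multiplicity 2 (2 * Suc n))"
    by (simp add: N_def del: mult_Suc mult_Suc_right)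
  then show "n < N (2 * Suc n)"
    by simp
qed

end

theory Submission
  imports Defs
begin

text \<open>
  Put \<open>e j = j * (3 * j + 1) / 2\<close>. By Euler's pentagonal number theorem the first series is
  \<open>T k = (\<Sum>j\<ge>k. (-1) ^ (j - k) * (q ^ e j - q ^ (e j + 2 * j + 1)))\<close> times the quotient \<open>R\<close> of the two
  infinite products, and the second one is \<open>q ^ (e k + 2 * k + 1) + T (k + 1)\<close> times \<open>R\<close>.
  Since \<open>N (2 * n) = n * (3 + \<nu> n)\<close>, \<open>R\<close> is the product of the polynomials
  \<open>1 + q ^ n + \<dots> + q ^ (n * (2 + \<nu> n))\<close>, and collecting the factors along suitable geometric
  progressions of indices shows that \<open>R\<close> is \<open>1 / ((1 - q) * (1 - q\<^sup>2) * (1 - q\<^sup>5))\<close> times a series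
  with nonnegative coefficients. It remains to see that
  \<open>T k / ((1 - q) * (1 - q\<^sup>2) * (1 - q\<^sup>5))\<close> has nonnegative coefficients for \<open>k \<ge> 1\<close>. The number of
  partitions into parts 1, 2 and 5 is quadratic up to a bounded error, the alternating sum of
  the quadratic main terms telescopes, and the main term wins except for finitely many small
  coefficients with \<open>k = 1\<close>.
\<close>

subsection \<open>Alternating sums over pentagonal numbers\<close>

definition pent :: "nat \<Rightarrow> nat" where
  "pent j = j * (3 * j + 1) div 2"

lemma two_pent: "2 * pent j = j * (3 * j + 1)"
proof -
  have "even (j * (3 * j + 1))" by simp
  then show ?thesis unfolding pent_def by simp
qed

lemma two_int_pent: "2 * int (pent j) = int j * (3 * int j + 1)"
proof -
  have "int (2 * pent j) = int (j * (3 * j + 1))" by (simp only: two_pent)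
  then show ?thesis by (simp only: of_nat_mult of_nat_add of_nat_numeral of_nat_1)
qed

lemma pent_mono: "i \<le> j \<Longrightarrow> pent i \<le> pent j"
  unfolding pent_def by (intro div_le_mono mult_le_mono) auto

lemma pent_Suc: "pent (Suc j) = pent j + 3 * j + 2"
  using two_pent[of j] two_pent[of "Suc j"] by (simp add: algebra_simps)

text \<open>
  The number of partitions of \<open>x\<close> into parts 1, 2 and 5 is the integer nearest to
  \<open>(x + 4)\<^sup>2 / 20\<close>. The closed form vanishes for \<open>-7 \<le> x < 0\<close> as well.
\<close>

definition count125 :: "int \<Rightarrow> int" where
  "count125 x = (if x < 0 then 0 else ((x + 4)\<^sup>2 + 10) div 20)"

lemma count125_neg: "x < 0 \<Longrightarrow> count125 x = 0"
  by (simp add: count125_def)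

lemma count125_mono: "x \<le> y \<Longrightarrow> count125 x \<le> count125 y"
  unfolding count125_def by (auto intro!: zdiv_mono1 power_mono simp: pos_imp_zdiv_nonneg_iff)

text \<open>Squares modulo 20 are 0, 1, 4, 5, 9 and 16, so \<open>(x + 4)\<^sup>2 + 10\<close>
  leaves a remainder between 6 and 19. For \<open>-7 \<le> x < 0\<close> the value 0 fits the same
  bounds because \<open>(x + 4)\<^sup>2 \<le> 9\<close> there.\<close>

lemma count125_bounds:
  assumes "x \<ge> -7"
  shows "(x + 4)\<^sup>2 - 9 \<le> 20 * count125 x" and "20 * count125 x \<le> (x + 4)\<^sup>2 + 4"
proof -
  have "(x + 4)\<^sup>2 - 9 \<le> 20 * count125 x \<and> 20 * count125 x \<le> (x + 4)\<^sup>2 + 4"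
  proof (cases "x < 0")
    case True
    with assms have "x \<in> {-7, -6, -5, -4, -3, -2, -1}" by auto
    then show ?thesis by (auto simp: count125_def)
  next
    case False
    define r where "r = (x + 4) mod 20"
    have "((x + 4)\<^sup>2 + 10) mod 20 = (r\<^sup>2 + 10) mod 20"
      unfolding r_def by (metis mod_add_left_eq power_mod)
    moreover have "r \<in> {0..19}" unfolding r_def by auto
    then have "r \<in> set [0..19]" by simp
    then have "(r\<^sup>2 + 10) mod 20 \<ge> 6 \<and> (r\<^sup>2 + 10) mod 20 \<le> 19"
      by (simp add: upto_rec1 del: set_upto) (elim disjE; simp)
    ultimately show ?thesis
      using False minus_mult_div_eq_mod[of "(x + 4)\<^sup>2 + 10" 20] by (simp add: count125_def)
  qed
  then show "(x + 4)\<^sup>2 - 9 \<le> 20 * count125 x" and "20 * count125 x \<le> (x + 4)\<^sup>2 + 4" by auto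
qed

text \<open>For natural \<open>x\<close> this is the coefficient of \<open>q ^ x\<close> in
  \<open>pent_term j * count125_fps\<close>.\<close>

definition count125_diff :: "nat \<Rightarrow> int \<Rightarrow> int" where
  "count125_diff j x = count125 (x - int (pent j)) - count125 (x - int (pent j) - (2 * int j + 1))"

text \<open>
  Replacing the count by \<open>(x + 4)\<^sup>2 / 20\<close> turns \<open>20 * count125_diff j x\<close> into
  \<open>(2 * j + 1) * (2 * (x + 4) - 3 * j\<^sup>2 - 3 * j - 1)\<close>, which is
  \<open>main_part j x + main_part (Suc j) x\<close>; so the alternating sums telescope.
\<close>

definition main_part :: "nat \<Rightarrow> int \<Rightarrow> int" where
  "main_part j x = int j * (2 * x + 10 - 3 * (int j)\<^sup>2)"

section \<open>Quadratic approximation of the alternating sums\<close>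

lemma count125_diff_nonneg: "count125_diff j x \<ge> 0"
  unfolding count125_diff_def using count125_mono[of "x - int (pent j) - (2 * int j + 1)" "x - int (pent j)"] by simp

lemma count125_diff_eq_0: "x < int (pent j) \<Longrightarrow> count125_diff j x = 0"
  by (simp add: count125_diff_def count125_neg)

text \<open>The 13 is 9 + 4, one rounding error from each of the two counts. The offset 6 keeps the
  smaller argument at least -7, where the bounds on \<open>count125\<close> hold.\<close>

lemma count125_diff_approx:
  assumes "x \<ge> int (pent j) + 2 * int j - 6"
  shows "\<bar>20 * count125_diff j x - (main_part j x + main_part (Suc j) x)\<bar> \<le> 13"
proof -
  define y where "y = x - int (pent j)"
  have x: "2 * x = int j * (3 * int j + 1) + 2 * y"
    using two_int_pent[of j] by (simp add: y_def)
  define z where "z = y - (2 * int j + 1)"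
  have "main_part j x + main_part (Suc j) x = (y + 4)\<^sup>2 - (z + 4)\<^sup>2"
    unfolding main_part_def x z_def by (simp add: algebra_simps power2_eq_square)
  moreover have "y \<ge> -7" "z \<ge> -7"
    using assms by (auto simp: y_def z_def)
  moreover have "count125_diff j x = count125 y - count125 z"
    by (simp add: count125_diff_def y_def z_def)
  ultimately show ?thesis
    using count125_bounds[of y] count125_bounds[of z] by linarith
qed

text \<open>Neighbouring main parts cancel and only the two end terms survive; each difference adds
  at most 13 to the error.\<close>

lemma alternating_count_diff_approx:
  assumes "\<And>i. i < m \<Longrightarrow> x \<ge> int (pent (k + i)) + 2 * int (k + i) - 6"
  shows "\<bar>20 * (\<Sum>i<m. (-1) ^ i * count125_diff (k + i) x) - (main_part k x - (-1) ^ m * main_part (k + m) x)\<bar>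
           \<le> 13 * int m"
  using assms
proof (induction m)
  case 0
  then show ?case by simp
next
  case (Suc m)
  have "\<bar>20 * count125_diff (k + m) x - (main_part (k + m) x + main_part (Suc (k + m)) x)\<bar> \<le> 13"
    by (rule count125_diff_approx) (use Suc.prems[of m] in simp)
  moreover have "\<bar>20 * (\<Sum>i<m. (-1) ^ i * count125_diff (k + i) x) - (main_part k x - (-1) ^ m * main_part (k + m) x)\<bar>
           \<le> 13 * int m"
    by (rule Suc.IH) (use Suc.prems in simp)
  ultimately show ?case
    by (cases "even m") (simp_all add: algebra_simps)
qed

lemma alternating_count_diff_cutoff:
  assumes "x < int (pent (k + m))" "m \<le> m'"
  shows "(\<Sum>i<m'. (-1) ^ i * count125_diff (k + i) x) = (\<Sum>i<m. (-1) ^ i * count125_diff (k + i) x)"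
proof (rule sum.mono_neutral_right)
  show "\<forall>i\<in>{..<m'} - {..<m}. (-1) ^ i * count125_diff (k + i) x = 0"
  proof
    fix i assume "i \<in> {..<m'} - {..<m}"
    then have "int (pent (k + m)) \<le> int (pent (k + i))" by (simp add: pent_mono)
    then show "(-1) ^ i * count125_diff (k + i) x = 0" using assms count125_diff_eq_0 by simp
  qed
qed (use assms in auto)

text \<open>
  In the next three lemmas \<open>k + d\<close> is the last index whose pentagonal number does not exceed
  \<open>x\<close>. The first two concern an \<open>x\<close> at which only the first half of the last difference is
  present, for even and odd \<open>d\<close>; the third one concerns complete last differences.
\<close>

lemma even_cut:
  fixes k d y x :: int
  assumes "k \<ge> 1" "d \<ge> 1" "2 \<le> k \<or> 11 \<le> d"
    and x: "2 * x = (k + d) * (3 * (k + d) + 1) + 2 * y"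
  shows "k * (2 * x + 10 - 3 * k\<^sup>2) - (k + d) * (2 * x + 10 - 3 * (k + d)\<^sup>2) + (y + 4)\<^sup>2 - 9 - 13 * d \<ge> 0"
proof -
  \<comment> \<open>Completing the square in \<open>y\<close> reduces the claim to the lower bound 9
    for the part free of \<open>y\<close>.\<close>
  have eq: "k * (2 * x + 10 - 3 * k\<^sup>2) - (k + d) * (2 * x + 10 - 3 * (k + d)\<^sup>2) + (y + 4)\<^sup>2 - 9 - 13 * d
      = d * (6 * k\<^sup>2 + 3 * k * d - k - 2 * d - 15) - 9 + (y - d + 4)\<^sup>2"
    unfolding x by (simp add: algebra_simps power2_eq_square)
  have "d * (6 * k\<^sup>2 + 3 * k * d - k - 2 * d - 15) \<ge> 9"
  \<comment> \<open>For \<open>k = 1\<close> the second factor is \<open>d - 10\<close>, hence the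
    threshold 11 for \<open>d\<close>; for \<open>k \<ge> 2\<close> it is at least 11
    already.\<close>
  proof (cases "k = 1")
    case True
    then have "d \<ge> 11" using assms by auto
    then have "11 * 1 \<le> d * (d - 10)" by (intro mult_mono) auto
    then show ?thesis using True by (simp add: algebra_simps)
  next
    case False
    define l where "l = k - 2"
    have l: "k = 2 + l" "l \<ge> 0" using False assms(1) by (auto simp: l_def)
    have "6 * k\<^sup>2 + 3 * k * d - k - 2 * d - 15 = 7 + 4 * d + 23 * l + 6 * l\<^sup>2 + 3 * (l * d)"
      unfolding l by (simp add: algebra_simps power2_eq_square)
    moreover have "l * d \<ge> 0" using l assms by simp
    moreover have "l\<^sup>2 \<ge> 0" by simp
    ultimately have "6 * k\<^sup>2 + 3 * k * d - k - 2 * d - 15 \<ge> 11" using l(2) assms(2) by linarith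
    then have "1 * 11 \<le> d * (6 * k\<^sup>2 + 3 * k * d - k - 2 * d - 15)"
      using assms by (intro mult_mono) auto
    then show ?thesis by simp
  qed
  then show ?thesis unfolding eq using zero_le_power2[of "y - d + 4"] by linarith
qed

lemma odd_cut:
  fixes k d y x :: int
  assumes "k \<ge> 1" "d \<ge> 1" "2 \<le> k \<or> 11 \<le> d"
    and x: "2 * x = (k + d) * (3 * (k + d) + 1) + 2 * y"
    and y: "0 \<le> y" "y \<le> 2 * (k + d)"
  shows "k * (2 * x + 10 - 3 * k\<^sup>2) + (k + d) * (2 * x + 10 - 3 * (k + d)\<^sup>2) - (y + 4)\<^sup>2 - 4 - 13 * d \<ge> 0"
proof -
  define j where "j = k + d"
  have "k * (2 * x + 10 - 3 * k\<^sup>2) + (k + d) * (2 * x + 10 - 3 * (k + d)\<^sup>2) - (y + 4)\<^sup>2 - 4 - 13 * d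
      = y * (2 * j - y) + k * (6 * k * d + 3 * d\<^sup>2 + k + d + 10) + 2 * k * y + j\<^sup>2 + 10 * j - 8 * y - 20 - 13 * d"
    unfolding x j_def by (simp add: algebra_simps power2_eq_square)
  moreover have "y * (2 * j - y) \<ge> 0" using y by (simp add: j_def)
  moreover have "k * (6 * k * d + 3 * d\<^sup>2 + k + d + 10) + 2 * k * y + j\<^sup>2 + 10 * j - 8 * y - 20 - 13 * d \<ge> 0"
  proof -
    obtain l where l: "k = 1 + l" "l \<ge> 0" using assms(1) by (metis add.commute diff_add_cancel diff_ge_0_iff_ge)
    obtain e where e: "d = 1 + e" "e \<ge> 0" using assms(2) by (metis add.commute diff_add_cancel diff_ge_0_iff_ge)
    have "(6 - 2 * k) * y \<le> 6 * y - 2 * y"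
      using mult_right_mono[OF assms(1) y(1)] by (simp add: algebra_simps)
    moreover have "(6 * y - 2 * y) + 2 * y \<le> 12 * j" using y by (simp add: j_def)
    ultimately have "8 * y - 2 * k * y \<le> 12 * j" by (simp add: algebra_simps)
    moreover have "k * (6 * k * d + 3 * d\<^sup>2 + k + d + 10) + j\<^sup>2 - 2 * j - 20 - 13 * d \<ge> 0"
    proof (cases "l = 0")
      case True
      then have "e \<ge> 10" using assms(3) l e by auto
      then have "10 * 1 \<le> e * e" by (intro mult_mono) auto
      then show ?thesis using True l e \<open>e \<ge> 10\<close> unfolding j_def by (simp add: algebra_simps power2_eq_square)
    next
      case False
      have nn: "l * e \<ge> 0" "l * l \<ge> 0" "e * e \<ge> 0" "l * (e * e) \<ge> 0" "l * (l * e) \<ge> 0" using l e by auto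
      have "l \<ge> 1" using False l by auto
      moreover have "k * (6 * k * d + 3 * d\<^sup>2 + k + d + 10) + j\<^sup>2 - 2 * j - 20 - 13 * d
        = 2 * e + 4 * (e * e) + 30 * l + 3 * (l * (e * e)) + 8 * (l * l) + 6 * (l * (l * e)) + 21 * (l * e) - 12"
        unfolding j_def l(1) e(1) by (simp add: algebra_simps power2_eq_square)
      ultimately show ?thesis using nn e(2) by linarith
    qed
    ultimately show ?thesis by simp
  qed
  ultimately show ?thesis by linarith
qed

lemma full_cut_bounds:
  fixes k d z x :: int
  assumes "k \<ge> 1" "d \<ge> 1" "2 \<le> k \<or> 11 \<le> d"
    and x: "2 * x + 10 = z + 3 * (k + d + 1)\<^sup>2"
    and z: "9 - (k + d) \<le> z" "z \<le> (k + d) + 9"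
  shows "k * (2 * x + 10 - 3 * k\<^sup>2) - (k + d + 1) * (2 * x + 10 - 3 * (k + d + 1)\<^sup>2) - 13 * (d + 1) \<ge> 0" (is ?A)
    and "k * (2 * x + 10 - 3 * k\<^sup>2) + (k + d + 1) * (2 * x + 10 - 3 * (k + d + 1)\<^sup>2) - 13 * (d + 1) \<ge> 0" (is ?B)
proof -
  \<comment> \<open>Shifting both variables to start at 0 makes almost all coefficients of the
    expanded polynomials nonnegative. The negative ones in \<open>?A\<close> are absorbed because
    \<open>l \<ge> 1\<close> or \<open>e \<ge> 10\<close>.\<close>
  obtain l where l: "k = 1 + l" "l \<ge> 0" using assms(1) by (metis add.commute diff_add_cancel diff_ge_0_iff_ge)
  obtain e where e: "d = 1 + e" "e \<ge> 0" using assms(2) by (metis add.commute diff_add_cancel diff_ge_0_iff_ge)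
  have nn: "l * e \<ge> 0" "l * l \<ge> 0" "e * e \<ge> 0" "l * (e * e) \<ge> 0" "l * (l * e) \<ge> 0" using l e by auto
  have c: "l \<ge> 1 \<or> e \<ge> 10" using assms(3) l e by auto
  have le': "e \<le> l * e" if "l \<ge> 1" using mult_right_mono[OF that e(2)] by simp
  have le: "e * e \<ge> 10 * e" if "e \<ge> 10" using that e by (intro mult_right_mono) auto
  have "k * (2 * x + 10 - 3 * k\<^sup>2) - (k + d + 1) * (2 * x + 10 - 3 * (k + d + 1)\<^sup>2) - 13 * (d + 1)
      = 3 * k * (2 * k + d + 1) * (d + 1) - (d + 1) * z - 13 * (d + 1)"
    unfolding x by (simp add: algebra_simps power2_eq_square)
  moreover have "(d + 1) * z \<le> (d + 1) * ((k + d) + 9)" using z assms by (intro mult_left_mono) auto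
  moreover have "3 * k * (2 * k + d + 1) * (d + 1) - (d + 1) * ((k + d) + 9) - 13 * (d + 1) \<ge> 0"
  proof -
    have "3 * k * (2 * k + d + 1) * (d + 1) - (d + 1) * ((k + d) + 9) - 13 * (d + 1)
      = 2 * (e * e) - 8 * e - 24 + 3 * (l * (e * e)) + 12 * (l * l) + 34 * l + 6 * (l * (l * e)) + 23 * (l * e)"
      unfolding l(1) e(1) by (simp add: algebra_simps)
    then show ?thesis using nn l(2) e(2) c le le' by linarith
  qed
  ultimately show ?A by linarith
  have "k * (2 * x + 10 - 3 * k\<^sup>2) + (k + d + 1) * (2 * x + 10 - 3 * (k + d + 1)\<^sup>2) - 13 * (d + 1)
      = 3 * k * (2 * k + d + 1) * (d + 1) + (2 * k + d + 1) * z - 13 * (d + 1)"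
    unfolding x by (simp add: algebra_simps power2_eq_square)
  moreover have "(2 * k + d + 1) * (9 - (k + d)) \<le> (2 * k + d + 1) * z" using z assms by (intro mult_left_mono) auto
  moreover have "3 * k * (2 * k + d + 1) * (d + 1) + (2 * k + d + 1) * (9 - (k + d)) - 13 * (d + 1) \<ge> 0"
  proof -
    have "3 * k * (2 * k + d + 1) * (d + 1) + (2 * k + d + 1) * (9 - (k + d)) - 13 * (d + 1)
      = 26 + 8 * e + 46 * l + 21 * (l * e) + 10 * (l * l) + 6 * (l * (l * e)) + 2 * (e * e) + 3 * (l * (e * e))"
      unfolding l(1) e(1) by (simp add: algebra_simps)
    then show ?thesis using nn l(2) e(2) by linarith
  qed
  ultimately show ?B by linarith
qed


text \<open>Cut the sum at the first pentagonal number above \<open>x\<close>. All differences but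
  possibly the last are then complete, so 20 times the sum is known up to 13 per complete
  difference, and the preceding inequalities show that the main term wins.\<close>

lemma alternating_count_diff_nonneg_large:
  assumes "k \<ge> 1" and m: "x < int (pent (k + m))"
    and large: "k \<ge> 2 \<or> x \<ge> 222"
  shows "0 \<le> (\<Sum>i<m. (-1) ^ i * count125_diff (k + i) x)"
proof -
  define m0 where "m0 = (LEAST m. x < int (pent (k + m)))"
  have m0: "x < int (pent (k + m0))" unfolding m0_def using m by (rule LeastI)
  have "m0 \<le> m" unfolding m0_def using m by (rule Least_le)
  then have sum_eq: "(\<Sum>i<m. (-1) ^ i * count125_diff (k + i) x) = (\<Sum>i<m0. (-1) ^ i * count125_diff (k + i) x)"
    by (rule alternating_count_diff_cutoff[OF m0])
  show ?thesis
  proof (cases "m0 = 0 \<or> m0 = 1")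
    case True
    then show ?thesis unfolding sum_eq using count125_diff_nonneg[of k x] by auto
  next
    case False
    define d where "d = m0 - 1"
    have d: "m0 = Suc d" "d \<ge> 1" using False by (auto simp: d_def)
    have lower: "int (pent (k + d)) \<le> x"
      using not_less_Least[of d "\<lambda>m. x < int (pent (k + m))"] d unfolding m0_def[symmetric] by simp
    have upper: "x < int (pent (k + d)) + 3 * int (k + d) + 2"
      using m0 d by (simp add: pent_Suc)
    define y where "y = x - int (pent (k + d))"
    have x: "2 * x = (int k + int d) * (3 * (int k + int d) + 1) + 2 * y"
      using two_int_pent[of "k + d"] by (simp add: y_def)
    have k: "int k \<ge> 1" and d': "int d \<ge> 1" using assms(1) d by auto
    \<comment> \<open>Since \<open>pent 12 = 222\<close>, for \<open>k = 1\<close> the bound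
      \<open>x \<ge> 222\<close> forces \<open>k + d + 1 > 12\<close>.\<close>
    have kd: "2 \<le> int k \<or> 11 \<le> int d"
    proof (rule ccontr)
      assume "\<not> ?thesis"
      then have "k = 1" "Suc (k + d) \<le> 12" using assms(1) by auto
      then have "x < int (pent 12)" using m0 d pent_mono[of "Suc (k + d)" 12] by simp
      then have "x < 222" by (simp add: pent_def)
      then show False using large \<open>k = 1\<close> by simp
    qed
    have below: "x \<ge> int (pent (k + i)) + 2 * int (k + i) - 6" if "i < d" for i
    proof -
      have "pent (Suc (k + i)) \<le> pent (k + d)" using that by (intro pent_mono) simp
      then show ?thesis using lower by (simp add: pent_Suc)
    qed
    show ?thesis
    \<comment> \<open>The second half of the last difference starts at
      \<open>y = 2 * (k + d) + 1\<close>; before that, the last term is just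
      \<open>count125 y\<close> with its sign.\<close>
    proof (cases "y \<le> 2 * int (k + d)")
      case True
      have "\<bar>20 * (\<Sum>i<d. (-1) ^ i * count125_diff (k + i) x)
          - (main_part k x - (-1) ^ d * main_part (k + d) x)\<bar> \<le> 13 * int d"
        using below by (rule alternating_count_diff_approx)
      moreover have "(\<Sum>i<m0. (-1) ^ i * count125_diff (k + i) x)
          = (\<Sum>i<d. (-1) ^ i * count125_diff (k + i) x) + (-1) ^ d * count125 y"
        using True by (simp add: d count125_diff_def y_def count125_neg)
      moreover have y0: "y \<ge> 0" using lower by (simp add: y_def)
      moreover note count125_bounds[of y]
      moreover note even_cut[OF k d' kd x]
      moreover have "int k * (2 * x + 10 - 3 * (int k)\<^sup>2)
          + (int k + int d) * (2 * x + 10 - 3 * (int k + int d)\<^sup>2) - (y + 4)\<^sup>2 - 4 - 13 * int d \<ge> 0"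
        using odd_cut[OF k d' kd x y0] True by simp
      ultimately show ?thesis
        unfolding sum_eq by (cases "even d") (simp_all add: main_part_def)
    next
      case False
      have "\<bar>20 * (\<Sum>i<m0. (-1) ^ i * count125_diff (k + i) x)
          - (main_part k x - (-1) ^ m0 * main_part (k + m0) x)\<bar> \<le> 13 * int m0"
      proof (rule alternating_count_diff_approx)
        fix i assume "i < m0"
        then consider "i < d" | "i = d" using d by linarith
        then show "x \<ge> int (pent (k + i)) + 2 * int (k + i) - 6"
          using below False by cases (auto simp: y_def)
      qed
      \<comment> \<open>\<open>z\<close> is the second factor of \<open>main_part\<close> at index
        \<open>k + d + 1\<close>. With \<open>j = k + d\<close>, its bounds come from
        \<open>2 * j + 1 \<le> y \<le> 3 * j + 1\<close>.\<close>
      moreover define z where "z = 2 * x + 10 - 3 * (int k + int d + 1)\<^sup>2"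
      have z: "2 * x + 10 = z + 3 * (int k + int d + 1)\<^sup>2" by (simp add: z_def)
      have zy: "z = 2 * y + 7 - 5 * (int k + int d)"
        unfolding z_def x by (simp add: algebra_simps power2_eq_square)
      have "9 - (int k + int d) \<le> z" "z \<le> (int k + int d) + 9"
        using False upper unfolding zy by (auto simp: y_def)
      note full_cut_bounds[OF k d' kd z this]
      ultimately show ?thesis
        unfolding sum_eq by (cases "even d") (simp_all add: main_part_def d algebra_simps)
    qed
  qed
qed

text \<open>The first eleven differences for \<open>k = 1\<close>, written out for evaluation: the
  offsets are \<open>pent j\<close> and \<open>pent j + 2 * j + 1\<close> for \<open>j\<close> from
  1 to 11. The next offset is \<open>pent 12 = 222\<close>.\<close>

definition alternating_one :: "int \<Rightarrow> int" where
  "alternating_one x =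
     count125 (x - 2) - count125 (x - 5) - count125 (x - 7) + count125 (x - 12) + count125 (x - 15) - count125 (x - 22)
   - count125 (x - 26) + count125 (x - 35) + count125 (x - 40) - count125 (x - 51) - count125 (x - 57) + count125 (x - 70)
   + count125 (x - 77) - count125 (x - 92) - count125 (x - 100) + count125 (x - 117) + count125 (x - 126) - count125 (x - 145)
   - count125 (x - 155) + count125 (x - 176) + count125 (x - 187) - count125 (x - 210)"

lemma alternating_one_small: "list_all (\<lambda>x. 0 \<le> alternating_one x) [0..221]"
  by code_simp

lemma alternating_count_diff_one_small:
  assumes "x < 222"
  shows "0 \<le> (\<Sum>i<11. (-1) ^ i * count125_diff (1 + i) x)"
proof (cases "x < 0")
  case True
  then show ?thesis by (simp add: count125_diff_eq_0)
next
  case False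
  have "(\<Sum>i<11. (-1) ^ i * count125_diff (1 + i) x) = alternating_one x"
    by (simp add: alternating_one_def count125_diff_def pent_def lessThan_nat_numeral)
  then show ?thesis
    using alternating_one_small False assms by (simp add: list_all_iff)
qed


lemma alternating_count_diff_nonneg:
  assumes "k \<ge> 1" and m: "x < int (pent (k + m))"
  shows "0 \<le> (\<Sum>i<m. (-1) ^ i * count125_diff (k + i) x)"
proof (cases "k \<ge> 2 \<or> x \<ge> 222")
  case True
  with assms show ?thesis by (rule alternating_count_diff_nonneg_large)
next
  case False
  then have k: "k = 1" and x: "x < 222" using assms(1) by auto
  have "x < int (pent (1 + 11))" using x by (simp add: pent_def)
  \<comment> \<open>Both \<open>m\<close> and 11 terms reach past \<open>x\<close>, so both sums
    agree with the one of \<open>max m 11\<close> terms.\<close>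
  then have "(\<Sum>i<max m 11. (-1) ^ i * count125_diff (1 + i) x) = (\<Sum>i<11. (-1) ^ i * count125_diff (1 + i) x)"
    by (rule alternating_count_diff_cutoff) simp
  moreover have "(\<Sum>i<max m 11. (-1) ^ i * count125_diff (1 + i) x) = (\<Sum>i<m. (-1) ^ i * count125_diff (1 + i) x)"
    using m unfolding k by (rule alternating_count_diff_cutoff) simp
  ultimately show ?thesis using alternating_count_diff_one_small[OF x] by (simp add: k)
qed

subsection \<open>Power series up to a given degree\<close>

text \<open>Congruence modulo \<open>fps_X ^ (n + 1)\<close>. It lets infinite products be replaced
  by finite ones, one degree at a time.\<close>

definition fps_eq_upto :: "nat \<Rightarrow> real fps \<Rightarrow> real fps \<Rightarrow> bool" where
  "fps_eq_upto n f g \<longleftrightarrow> (\<forall>i\<le>n. fps_nth f i = fps_nth g i)"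

lemma fps_eq_upto_refl [simp, intro]: "fps_eq_upto n f f"
  by (simp add: fps_eq_upto_def)

lemma fps_eq_upto_sym: "fps_eq_upto n f g \<Longrightarrow> fps_eq_upto n g f"
  by (simp add: fps_eq_upto_def)

lemma fps_eq_upto_trans [trans]: "fps_eq_upto n f g \<Longrightarrow> fps_eq_upto n g h \<Longrightarrow> fps_eq_upto n f h"
  by (simp add: fps_eq_upto_def)

lemma fps_eq_upto_mono: "fps_eq_upto n f g \<Longrightarrow> m \<le> n \<Longrightarrow> fps_eq_upto m f g"
  by (simp add: fps_eq_upto_def)

lemma fps_eq_upto_add: "fps_eq_upto n f g \<Longrightarrow> fps_eq_upto n f' g' \<Longrightarrow> fps_eq_upto n (f + f') (g + g')"
  by (simp add: fps_eq_upto_def)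

lemma fps_eq_upto_diff: "fps_eq_upto n f g \<Longrightarrow> fps_eq_upto n f' g' \<Longrightarrow> fps_eq_upto n (f - f') (g - g')"
  by (simp add: fps_eq_upto_def)

lemma fps_eq_upto_mult: "fps_eq_upto n f g \<Longrightarrow> fps_eq_upto n f' g' \<Longrightarrow> fps_eq_upto n (f * f') (g * g')"
  unfolding fps_eq_upto_def fps_mult_nth by (auto intro!: sum.cong)

lemma fps_eq_upto_prod:
  "(\<And>i. i \<in> A \<Longrightarrow> fps_eq_upto n (f i) (g i)) \<Longrightarrow> fps_eq_upto n (prod f A) (prod g A)"
  by (induction A rule: infinite_finite_induct) (auto intro: fps_eq_upto_mult)

lemma fps_eq_upto_sum:
  "(\<And>i. i \<in> A \<Longrightarrow> fps_eq_upto n (f i) (g i)) \<Longrightarrow> fps_eq_upto n (sum f A) (sum g A)"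
  by (induction A rule: infinite_finite_induct) (auto intro: fps_eq_upto_add)

lemma fps_eq_upto_X_power: "n < m \<Longrightarrow> fps_eq_upto n (fps_X ^ m) 0"
  by (auto simp: fps_eq_upto_def fps_X_power_iff)

lemma fps_eq_upto_one_minus: "n < m \<Longrightarrow> fps_eq_upto n (1 - fps_X ^ m) 1"
  by (auto simp: fps_eq_upto_def fps_X_power_iff)

lemma prodinf_eq_upto:
  fixes e :: "nat \<Rightarrow> nat"
  assumes e: "\<And>n. n < e n" and "n \<le> m"
  shows "fps_eq_upto n (\<Prod>k. 1 - fps_X ^ e k) (\<Prod>k<m. 1 - fps_X ^ e k)"
proof -
  let ?f = "\<lambda>n. 1 - fps_X ^ e n :: real fps"
  have "(\<lambda>n. \<Prod>k<n. ?f k) \<longlonglongrightarrow> (\<Prod>k. ?f k)"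
    using has_prod_one_minus_fps_X_power[of e] e by (intro has_prod_imp_tendsto') auto
  then have "\<forall>i\<in>{..n}. \<forall>\<^sub>F M in sequentially. fps_nth (\<Prod>k<M. ?f k) i = fps_nth (\<Prod>k. ?f k) i"
    by (simp add: tendsto_fps_iff)
  then have "\<forall>\<^sub>F M in sequentially. \<forall>i\<in>{..n}. fps_nth (\<Prod>k<M. ?f k) i = fps_nth (\<Prod>k. ?f k) i"
    by (intro eventually_ball_finite) auto
  then obtain M0 where M0: "\<And>M. M \<ge> M0 \<Longrightarrow> \<forall>i\<in>{..n}. fps_nth (\<Prod>k<M. ?f k) i = fps_nth (\<Prod>k. ?f k) i"
    by (auto simp: eventually_sequentially)
  \<comment> \<open>By convergence the coefficients up to \<open>n\<close> are stable from
    \<open>M0\<close> on; the factors from \<open>m\<close> to \<open>M\<close> are then 1 up to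
    degree \<open>n\<close>.\<close>
  define M where "M = max M0 m"
  have "fps_eq_upto n (\<Prod>k. ?f k) (\<Prod>k<M. ?f k)"
    using M0[of M] by (simp add: fps_eq_upto_def M_def)
  also have "(\<Prod>k<M. ?f k) = (\<Prod>k<m. ?f k) * (\<Prod>k=m..<M. ?f k)"
    by (subst prod.union_disjoint [symmetric]) (auto simp: M_def intro!: prod.cong)
  also have "fps_eq_upto n \<dots> ((\<Prod>k<m. ?f k) * (\<Prod>k=m..<M. 1))"
  proof (intro fps_eq_upto_mult fps_eq_upto_prod fps_eq_upto_refl fps_eq_upto_one_minus)
    fix k assume "k \<in> {m..<M}"
    then show "n < e k" using e[of k] assms(2) by simp
  qed
  finally show ?thesis by simp
qed

subsection \<open>The pentagonal number theorem\<close>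

definition pent_term :: "nat \<Rightarrow> real fps" where
  "pent_term j = fps_X ^ pent j - fps_X ^ (pent j + 2 * j + 1)"

text \<open>For \<open>s = n\<close> the left side is the change of Shanks's finite sum from
  \<open>n\<close> to \<open>n + 1\<close> over the indices \<open>r \<le> n\<close>. Stating it for
  every \<open>s\<close> permits an induction in which the sum telescopes.\<close>

lemma shanks_partial:
  fixes x :: "'a :: comm_ring_1"
  defines "Q \<equiv> \<lambda>r n. \<Prod>i=r..<n. 1 - x ^ Suc i"
  assumes "s \<le> n"
  shows "(\<Sum>r\<le>s. (-1) ^ r * Q r n * ((1 - x ^ Suc n) * x ^ (r * Suc n + \<Sum>{..r}) - x ^ (r * n + \<Sum>{..r})))
    = (-1) ^ Suc s * Q s n * x ^ (Suc s * Suc n + \<Sum>{..s})"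
  using assms(2)
proof (induction s)
  case 0
  then show ?case by (simp add: algebra_simps)
next
  case (Suc s)
  \<comment> \<open>\<open>P\<close> is the common factor of the collapsed sum and the new
    summand.\<close>
  define P where "P = (-1) ^ Suc s * Q (Suc s) n * x ^ (Suc s * n + \<Sum>{..Suc s})"
  have Q: "Q s n = (1 - x ^ Suc s) * Q (Suc s) n"
    unfolding Q_def using Suc.prems by (subst prod.atLeast_Suc_lessThan) auto
  have "(\<Sum>r\<le>Suc s. (-1) ^ r * Q r n * ((1 - x ^ Suc n) * x ^ (r * Suc n + \<Sum>{..r}) - x ^ (r * n + \<Sum>{..r})))
     = (-1) ^ Suc s * Q s n * x ^ (Suc s * Suc n + \<Sum>{..s})
      + (-1) ^ Suc s * Q (Suc s) n * ((1 - x ^ Suc n) * x ^ (Suc s * Suc n + \<Sum>{..Suc s}) - x ^ (Suc s * n + \<Sum>{..Suc s}))"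
    using Suc by simp
  also have "(-1) ^ Suc s * Q s n * x ^ (Suc s * Suc n + \<Sum>{..s}) = P * (1 - x ^ Suc s)"
    unfolding Q P_def by (simp add: algebra_simps power_add)
  also have "(-1) ^ Suc s * Q (Suc s) n * ((1 - x ^ Suc n) * x ^ (Suc s * Suc n + \<Sum>{..Suc s}) - x ^ (Suc s * n + \<Sum>{..Suc s}))
      = P * ((1 - x ^ Suc n) * x ^ Suc s - 1)"
    unfolding P_def by (simp add: algebra_simps power_add)
  also have "P * (1 - x ^ Suc s) + P * ((1 - x ^ Suc n) * x ^ Suc s - 1) = - (P * (x ^ Suc n * x ^ Suc s))"
    by (simp add: algebra_simps)
  also have "\<dots> = (-1) ^ Suc (Suc s) * Q (Suc s) n * x ^ (Suc (Suc s) * Suc n + \<Sum>{..Suc s})"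
    unfolding P_def by (simp add: algebra_simps power_add)
  finally show ?case .
qed

lemma pent_eq_square_add: "pent n = n\<^sup>2 + \<Sum>{..n}"
proof -
  have "2 * pent n = 2 * (n\<^sup>2 + \<Sum>{..n})"
    unfolding two_pent by (induction n) (simp_all add: power2_eq_square algebra_simps)
  then show ?thesis by simp
qed

lemma le_pent: "j \<le> pent j"
  using le_square[of j] unfolding pent_eq_square_add power2_eq_square by (rule trans_le_add1)

text \<open>Shanks's finite form of the pentagonal number theorem. The summand \<open>r = 0\<close>
  is the finite Euler product, and all others are divisible by
  \<open>fps_X ^ (n + 1)\<close>.\<close>

lemma shanks_identity:
  "(\<Sum>r\<le>n. (-1) ^ r * (\<Prod>i=r..<n. 1 - fps_X ^ Suc i) * fps_X ^ (r * n + \<Sum>{..r}))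
    = (\<Sum>j<n. (-1) ^ j * pent_term j) + (-1) ^ n * fps_X ^ pent n" (is "?A n = ?R n")
proof (induction n)
  case 0
  then show ?case by (simp add: pent_def)
next
  case (Suc n)
  let ?Q = "\<lambda>r n. \<Prod>i=r..<n. 1 - fps_X ^ Suc i :: real fps"
  have "?A (Suc n) = (\<Sum>r\<le>n. (-1) ^ r * ?Q r (Suc n) * fps_X ^ (r * Suc n + \<Sum>{..r}))
      + (-1) ^ Suc n * fps_X ^ (Suc n * Suc n + \<Sum>{..Suc n})"
    by simp
  also have "(\<Sum>r\<le>n. (-1) ^ r * ?Q r (Suc n) * fps_X ^ (r * Suc n + \<Sum>{..r})) - ?A n
      = (\<Sum>r\<le>n. (-1) ^ r * ?Q r n * ((1 - fps_X ^ Suc n) * fps_X ^ (r * Suc n + \<Sum>{..r}) - fps_X ^ (r * n + \<Sum>{..r})))"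
    unfolding sum_subtractf [symmetric] by (intro sum.cong) (auto simp: algebra_simps)
  then have "(\<Sum>r\<le>n. (-1) ^ r * ?Q r (Suc n) * fps_X ^ (r * Suc n + \<Sum>{..r}))
      = ?A n + (-1) ^ Suc n * fps_X ^ (Suc n * Suc n + \<Sum>{..n})"
    unfolding shanks_partial[OF order_refl] by (simp add: algebra_simps)
  also have "?A n = ?R n" by (rule Suc.IH)
  also have "Suc n * Suc n + \<Sum>{..n} = pent n + 2 * n + 1"
    by (simp add: pent_eq_square_add power2_eq_square)
  also have "Suc n * Suc n + \<Sum>{..Suc n} = pent (Suc n)"
    by (simp add: pent_eq_square_add power2_eq_square)
  finally show ?case by (simp add: pent_term_def algebra_simps)
qed

lemma euler_prod_eq_upto:
  assumes "n \<le> m"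
  shows "fps_eq_upto n euler_prod (\<Sum>j<Suc m. (-1) ^ j * pent_term j)"
proof -
  let ?g = "\<lambda>r. (-1) ^ r * (\<Prod>i=r..<m. 1 - fps_X ^ Suc i) * fps_X ^ (r * m + \<Sum>{..r}) :: real fps"
  have "fps_eq_upto n euler_prod (\<Prod>k<m. 1 - fps_X ^ Suc k)"
    unfolding euler_prod_def by (rule prodinf_eq_upto) (use assms in auto)
  also have "(\<Prod>k<m. 1 - fps_X ^ Suc k) = (\<Sum>r\<le>m. if r = 0 then ?g r else 0)"
    by (simp add: atLeast0LessThan)
  also have "fps_eq_upto n \<dots> (\<Sum>r\<le>m. ?g r)"
  proof (rule fps_eq_upto_sum)
    fix r
    show "fps_eq_upto n (if r = 0 then ?g r else 0) (?g r)"
    proof (cases r)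
      case (Suc l)
      then have "n < r * m + \<Sum>{..r}" using assms by simp
      then have "fps_eq_upto n (?g r) ((-1) ^ r * (\<Prod>i=r..<m. 1 - fps_X ^ Suc i) * 0)"
        by (intro fps_eq_upto_mult fps_eq_upto_X_power fps_eq_upto_refl)
      then show ?thesis using Suc fps_eq_upto_sym by simp
    qed simp
  qed
  \<comment> \<open>Subtracting 0 gives the last summand the shape of \<open>pent_term m\<close>,
    whose second exponent exceeds \<open>n\<close>.\<close>
  also have "(\<Sum>r\<le>m. ?g r) = (\<Sum>j<m. (-1) ^ j * pent_term j) + (-1) ^ m * (fps_X ^ pent m - 0)"
    using shanks_identity[of m] by simp
  also have "fps_eq_upto n \<dots> ((\<Sum>j<m. (-1) ^ j * pent_term j) + (-1) ^ m * pent_term m)"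
    unfolding pent_term_def
    by (intro fps_eq_upto_add fps_eq_upto_mult fps_eq_upto_diff fps_eq_upto_refl
        fps_eq_upto_sym[OF fps_eq_upto_X_power]) (use assms in simp)
  finally show ?thesis by simp
qed

section \<open>Pentagonal sums over integer indices and the tail of Euler's series\<close>

lemma pentagonal_uminus_nat: "pentagonal (- int k) = pent k"
proof -
  have "- int k * (3 * (- int k) - 1) = int (k * (3 * k + 1))" by (simp add: algebra_simps)
  then have "- int k * (3 * (- int k) - 1) div 2 = int (pent k)"
    by (simp only: pent_def zdiv_int of_nat_numeral)
  then show ?thesis by (simp only: pentagonal_def nat_int)
qed

lemma pentagonal_nat_Suc: "pentagonal (1 + int k) = pent k + 2 * k + 1"
proof -
  have "(1 + int k) * (3 * (1 + int k) - 1) = 2 * int (pent k + 2 * k + 1)"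
    using two_int_pent[of k] by (simp add: algebra_simps)
  then have "(1 + int k) * (3 * (1 + int k) - 1) div 2 = int (pent k + 2 * k + 1)"
    by simp
  then show ?thesis by (simp only: pentagonal_def nat_int)
qed

lemma powi_minus_one_uminus: "(-1 :: real) powi (- int k) = (-1) ^ k"
  by (simp add: power_int_minus flip: power_inverse)

lemma fps_const_minus_one_power: "fps_const ((-1 :: real) ^ k) = (-1) ^ k"
  by (simp flip: fps_const_power fps_const_neg)

text \<open>The indices \<open>- j\<close> and \<open>j + 1\<close> carry opposite signs and supply
  the two exponents of \<open>pent_term j\<close>, so the range splits into \<open>k\<close> such
  pairs.\<close>

lemma pentagonal_sum_even: "pentagonal_sum (1 - int k) (int k) = (\<Sum>j<k. (-1) ^ j * pent_term j)"
proof (induction k)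
  case 0
  then show ?case by (simp add: pentagonal_sum_def)
next
  case (Suc k)
  have "{1 - int (Suc k)..int (Suc k)} = insert (- int k) (insert (int k + 1) {1 - int k..int k})"
    by auto
  then have "pentagonal_sum (1 - int (Suc k)) (int (Suc k))
     = (-1) ^ k * fps_X ^ pent k + ((-1) ^ Suc k * fps_X ^ (pent k + 2 * k + 1)
       + pentagonal_sum (1 - int k) (int k))"
    using powi_minus_one_uminus[of k] power_int_of_nat[of "-1::real" "Suc k"]
    by (simp add: pentagonal_sum_def pentagonal_uminus_nat pentagonal_nat_Suc
        fps_const_minus_one_power[symmetric] add.commute)
  then show ?case by (simp add: Suc.IH pent_term_def algebra_simps)
qed

lemma pentagonal_sum_odd:
  "pentagonal_sum (- int k) (int k) = pentagonal_sum (1 - int k) (int k) + (-1) ^ k * fps_X ^ pent k"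
proof -
  have "{- int k..int k} = insert (- int k) {1 - int k..int k}" by auto
  then show ?thesis
    using powi_minus_one_uminus[of k]
    by (simp add: pentagonal_sum_def pentagonal_uminus_nat fps_const_minus_one_power)
qed

text \<open>The series \<open>T k\<close> of the overview, defined as a remainder instead of an
  infinite sum.\<close>

definition pent_tail :: "nat \<Rightarrow> real fps" where
  "pent_tail k = (-1) ^ k * (euler_prod - pentagonal_sum (1 - int k) (int k))"

lemma pent_tail_eq_upto:
  assumes "n < m"
  shows "fps_eq_upto n (pent_tail k) (\<Sum>i<m. (-1) ^ i * pent_term (k + i))"
proof -
  have "(\<Sum>j<k + m. (-1) ^ j * pent_term j) = (\<Sum>j<k. (-1) ^ j * pent_term j) + (\<Sum>j=k..<k + m. (-1) ^ j * pent_term j)"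
    using sum.atLeastLessThan_concat[of 0 k "k + m" "\<lambda>j. (-1) ^ j * pent_term j"]
    by (simp add: atLeast0LessThan)
  also have "(\<Sum>j=k..<k + m. (-1) ^ j * pent_term j) = (-1) ^ k * (\<Sum>i<m. (-1) ^ i * pent_term (k + i))"
    using sum.shift_bounds_nat_ivl[of "\<lambda>j. (-1) ^ j * pent_term j" 0 k m]
    by (simp add: sum_distrib_left power_add mult_ac atLeast0LessThan add.commute)
  finally have eq: "(\<Sum>i<m. (-1) ^ i * pent_term (k + i))
      = (-1) ^ k * ((\<Sum>j<k + m. (-1) ^ j * pent_term j) - pentagonal_sum (1 - int k) (int k))"
    by (simp add: pentagonal_sum_even flip: mult.assoc power_add)
  have "fps_eq_upto n euler_prod (\<Sum>j<k + m. (-1) ^ j * pent_term j)"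
    using euler_prod_eq_upto[of n "k + m - 1"] assms by simp
  then show ?thesis unfolding eq pent_tail_def
    by (intro fps_eq_upto_mult fps_eq_upto_diff fps_eq_upto_refl)
qed

lemma pent_tail_Suc: "pent_tail k = pent_term k - pent_tail (Suc k)"
  unfolding pent_tail_def pentagonal_sum_even
  by (simp add: algebra_simps flip: power_add mult.assoc)

subsection \<open>The generating function of partitions into parts 1, 2 and 5\<close>

text \<open>The signs are those of the expanded
  \<open>(1 - q) * (1 - q\<^sup>2) * (1 - q\<^sup>5)\<close>. For \<open>n = 10 * a + r\<close> all
  terms in \<open>a\<close> cancel, as the signs and the signed shifts both sum to 0, which leaves
  ten residues. The assumption keeps every argument at least -7, where the closed form is
  valid.\<close>

lemma count125_recurrence:
  assumes "n \<ge> 1"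
  shows "count125 n - count125 (n - 1) - count125 (n - 2) + count125 (n - 3) - count125 (n - 5) + count125 (n - 6) + count125 (n - 7) - count125 (n - 8) = 0"
proof -
  have quad: "count125 x = ((x + 4)\<^sup>2 + 10) div 20" if "x \<ge> -7" for x
  proof (cases "x < 0")
    case True
    with that have "x \<in> {-7, -6, -5, -4, -3, -2, -1}" by auto
    then show ?thesis by (auto simp: count125_def)
  qed (simp add: count125_def)
  define a r where "a = n div 10" and "r = n mod 10"
  have n: "n = 10 * a + r" by (simp add: a_def r_def)
  have shift: "count125 (10 * a + t) = 5 * a\<^sup>2 + a * (t + 4) + ((t + 4)\<^sup>2 + 10) div 20" if "10 * a + t \<ge> -7" for t
  proof -
    have "(10 * a + t + 4)\<^sup>2 + 10 = (t + 4)\<^sup>2 + 10 + 20 * (5 * a\<^sup>2 + a * (t + 4))"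
      by (simp add: power2_eq_square algebra_simps)
    then show ?thesis using quad[OF that] by simp
  qed
  define q where "q t = ((t + 4)\<^sup>2 + 10) div 20" for t :: int
  have c: "count125 (n - i) = 5 * a\<^sup>2 + a * (r + 4) - a * i + q (r - i)" if "i \<le> 8" for i
    using shift[of "r - i"] that assms by (simp add: n add_diff_eq q_def algebra_simps)
  have "count125 n - count125 (n - 1) - count125 (n - 2) + count125 (n - 3) - count125 (n - 5) + count125 (n - 6) + count125 (n - 7) - count125 (n - 8)
    = q r - q (r - 1) - q (r - 2) + q (r - 3) - q (r - 5) + q (r - 6) + q (r - 7) - q (r - 8)"
    using c[of 0] c[of 1] c[of 2] c[of 3] c[of 5] c[of 6] c[of 7] c[of 8] by simp
  moreover have "0 \<le> r" "r < 10" by (simp_all add: r_def)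
  then have "r \<in> {0, 1, 2, 3, 4, 5, 6, 7, 8, 9}" by (simp, presburger)
  then have "q r - q (r - 1) - q (r - 2) + q (r - 3) - q (r - 5) + q (r - 6) + q (r - 7) - q (r - 8) = 0"
    unfolding insert_iff empty_iff by (elim disjE) (simp_all add: q_def)
  ultimately show ?thesis by simp
qed

definition count125_fps :: "real fps" where
  "count125_fps = Abs_fps (\<lambda>n. of_int (count125 (int n)))"

lemma nth_X_power_mult_count125_fps: "fps_nth (fps_X ^ e * count125_fps) n = of_int (count125 (int n - int e))"
  by (auto simp: count125_fps_def fps_X_power_mult_nth count125_neg of_nat_diff)

lemma count125_fps_inverse: "(1 - fps_X) * (1 - fps_X ^ 2) * (1 - fps_X ^ 5) * count125_fps = 1"
proof -
  have "(1 - fps_X) * (1 - fps_X ^ 2) * (1 - fps_X ^ 5) * count125_fps =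
     fps_X ^ 0 * count125_fps - fps_X ^ 1 * count125_fps - fps_X ^ 2 * count125_fps + fps_X ^ 3 * count125_fps
     - fps_X ^ 5 * count125_fps + fps_X ^ 6 * count125_fps + fps_X ^ 7 * count125_fps - fps_X ^ 8 * count125_fps"
    by (simp add: algebra_simps eval_nat_numeral)
  also have "\<dots> = 1"
  proof (rule fps_ext)
    fix n
    have "fps_nth (fps_X ^ 0 * count125_fps - fps_X ^ 1 * count125_fps - fps_X ^ 2 * count125_fps + fps_X ^ 3 * count125_fps
     - fps_X ^ 5 * count125_fps + fps_X ^ 6 * count125_fps + fps_X ^ 7 * count125_fps - fps_X ^ 8 * count125_fps) n
      = of_int (count125 (int n) - count125 (int n - 1) - count125 (int n - 2) + count125 (int n - 3) - count125 (int n - 5)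
         + count125 (int n - 6) + count125 (int n - 7) - count125 (int n - 8))"
      unfolding fps_add_nth fps_sub_nth nth_X_power_mult_count125_fps by simp
    also have "\<dots> = fps_nth 1 n"
    proof (cases "n = 0")
      case True
      then show ?thesis by (simp add: count125_def)
    next
      case False
      then show ?thesis using count125_recurrence[of "int n"] by simp
    qed
    finally show "fps_nth (fps_X ^ 0 * count125_fps - fps_X ^ 1 * count125_fps - fps_X ^ 2 * count125_fps + fps_X ^ 3 * count125_fps
     - fps_X ^ 5 * count125_fps + fps_X ^ 6 * count125_fps + fps_X ^ 7 * count125_fps - fps_X ^ 8 * count125_fps) n = fps_nth 1 n" .
  qed
  finally show ?thesis .
qed

lemma pent_tail_count125_in_nat_fps:
  assumes "k \<ge> 1"
  shows "pent_tail k * count125_fps \<in> nat_fps"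
  unfolding nat_fps_def
proof (intro CollectI allI)
  fix n :: nat
  \<comment> \<open>By \<open>le_pent\<close>, \<open>pent (k + m)\<close> exceeds \<open>n\<close>,
    so \<open>m\<close> terms determine the coefficient of degree \<open>n\<close>.\<close>
  define m where "m = n + 12"
  have "fps_eq_upto n (pent_tail k * count125_fps) ((\<Sum>i<m. (-1) ^ i * pent_term (k + i)) * count125_fps)"
    by (intro fps_eq_upto_mult pent_tail_eq_upto fps_eq_upto_refl) (simp add: m_def)
  then have "fps_nth (pent_tail k * count125_fps) n = (\<Sum>i<m. fps_nth ((-1) ^ i * (pent_term (k + i) * count125_fps)) n)"
    by (simp add: fps_eq_upto_def sum_distrib_right fps_sum_nth mult.assoc)
  also have "\<dots> = (\<Sum>i<m. of_int ((-1) ^ i * count125_diff (k + i) (int n)))"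
  proof (rule sum.cong)
    fix i
    have "fps_nth (pent_term j * count125_fps) n = of_int (count125_diff j (int n))" for j
      unfolding pent_term_def left_diff_distrib fps_sub_nth nth_X_power_mult_count125_fps count125_diff_def
      by (simp add: algebra_simps)
    moreover have "fps_nth ((-1) ^ i * f) n = (-1) ^ i * fps_nth f n" for f :: "real fps"
      by (cases "even i") auto
    ultimately show "fps_nth ((-1) ^ i * (pent_term (k + i) * count125_fps)) n = of_int ((-1) ^ i * count125_diff (k + i) (int n))"
      by simp
  qed simp
  also have "\<dots> = of_int (\<Sum>i<m. (-1) ^ i * count125_diff (k + i) (int n))" by simp
  finally have eq: "fps_nth (pent_tail k * count125_fps) n = of_int (\<Sum>i<m. (-1) ^ i * count125_diff (k + i) (int n))" .
  have "0 \<le> (\<Sum>i<m. (-1) ^ i * count125_diff (k + i) (int n))"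
  proof (rule alternating_count_diff_nonneg[OF assms])
    show "int n < int (pent (k + m))"
      using le_pent[of "k + m"] by (simp add: m_def)
  qed
  then obtain c where "(\<Sum>i<m. (-1) ^ i * count125_diff (k + i) (int n)) = int c"
    using nonneg_int_cases by blast
  then show "fps_nth (pent_tail k * count125_fps) n \<in> \<nat>"
    unfolding eq by simp
qed

subsection \<open>The product side\<close>

definition geometric_fps :: "nat \<Rightarrow> nat \<Rightarrow> real fps" where
  "geometric_fps d n = (\<Sum>i<d. fps_X ^ (n * i))"

lemma one_minus_mult_geometric_fps: "(1 - fps_X ^ n) * geometric_fps d n = 1 - fps_X ^ (n * d)"
  unfolding geometric_fps_def power_mult by (rule one_diff_power_eq [symmetric])

section \<open>Closure properties of series with natural coefficients\<close>

lemma nat_fps_zero: "0 \<in> nat_fps" and nat_fps_one: "1 \<in> nat_fps"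
  by (simp_all add: nat_fps_def)

lemma nat_fps_add: "f \<in> nat_fps \<Longrightarrow> g \<in> nat_fps \<Longrightarrow> f + g \<in> nat_fps"
  by (simp add: nat_fps_def)

lemma sum_in_Nats: "(\<And>i. i \<in> A \<Longrightarrow> f i \<in> \<nat>) \<Longrightarrow> sum f A \<in> \<nat>"
  by (induction A rule: infinite_finite_induct) auto

lemma nat_fps_mult: "f \<in> nat_fps \<Longrightarrow> g \<in> nat_fps \<Longrightarrow> f * g \<in> nat_fps"
  by (auto simp: nat_fps_def fps_mult_nth intro!: sum_in_Nats)

lemma nat_fps_X_power: "fps_X ^ n \<in> nat_fps"
  by (simp add: nat_fps_def fps_X_power_iff)

lemma nat_fps_sum: "(\<And>i. i \<in> A \<Longrightarrow> f i \<in> nat_fps) \<Longrightarrow> sum f A \<in> nat_fps"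
  by (induction A rule: infinite_finite_induct) (auto intro: nat_fps_add nat_fps_zero)

lemma nat_fps_prod: "(\<And>i. i \<in> A \<Longrightarrow> f i \<in> nat_fps) \<Longrightarrow> prod f A \<in> nat_fps"
  by (induction A rule: infinite_finite_induct) (auto intro: nat_fps_mult nat_fps_one)

lemma nat_fps_geometric: "geometric_fps d n \<in> nat_fps"
  unfolding geometric_fps_def by (intro nat_fps_sum nat_fps_X_power)

lemma nat_fpsI_eq_upto:
  assumes "\<And>n. \<exists>g\<in>nat_fps. fps_eq_upto n f g"
  shows "f \<in> nat_fps"
proof -
  have "fps_nth f n \<in> \<nat>" for n
    using assms[of n] by (auto simp: nat_fps_def fps_eq_upto_def)
  then show ?thesis by (simp add: nat_fps_def)
qed

text \<open>
  A sub-product along \<open>s, s * d, s * d\<^sup>2, \<dots>\<close> telescopes to \<open>1 / (1 - q\<^sup>s)\<close>.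
\<close>

lemma geometric_chain:
  assumes "s \<ge> 1" "d \<ge> 2"
  obtains A where "A \<subseteq> {1..l}" "A \<subseteq> range (\<lambda>i. s * d ^ i)"
    "fps_eq_upto l ((1 - fps_X ^ s) * (\<Prod>n\<in>A. geometric_fps d n)) 1"
proof -
  have inj: "inj (\<lambda>i. s * d ^ i)"
    using assms by (auto intro!: injI)
  have "l < s * d ^ l"
  proof -
    have "l < 2 ^ l" by (rule less_exp)
    also have "2 ^ l \<le> d ^ l" using assms by (intro power_mono) auto
    also have "\<dots> \<le> s * d ^ l" using assms by simp
    finally show ?thesis .
  qed
  \<comment> \<open>Minimality keeps the indices \<open>s * d ^ i\<close> with \<open>i < m\<close>
    within \<open>{1..l}\<close>, while the leftover factor \<open>1 - fps_X ^ (s * d ^ m)\<close>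
    is 1 up to degree \<open>l\<close>.\<close>
  then obtain m where m: "l < s * d ^ m" and least: "\<And>i. i < m \<Longrightarrow> \<not> l < s * d ^ i"
    using exists_least_iff[of "\<lambda>i. l < s * d ^ i"] by blast
  have telescope: "(1 - fps_X ^ s) * (\<Prod>i<j. geometric_fps d (s * d ^ i)) = 1 - fps_X ^ (s * d ^ j)" for j
  proof (induction j)
    case 0
    then show ?case by simp
  next
    case (Suc j)
    have "(1 - fps_X ^ s) * (\<Prod>i<Suc j. geometric_fps d (s * d ^ i))
      = (1 - fps_X ^ s) * (\<Prod>i<j. geometric_fps d (s * d ^ i)) * geometric_fps d (s * d ^ j)"
      by (simp add: mult.assoc)
    also have "\<dots> = 1 - fps_X ^ (s * d ^ Suc j)"
      unfolding Suc.IH one_minus_mult_geometric_fps by (simp add: mult_ac)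
    finally show ?case .
  qed
  let ?A = "(\<lambda>i. s * d ^ i) ` {..<m}"
  have "(\<Prod>n\<in>?A. geometric_fps d n) = (\<Prod>i<m. geometric_fps d (s * d ^ i))"
    by (subst prod.reindex) (auto intro: inj_on_subset[OF inj])
  then have "fps_eq_upto l ((1 - fps_X ^ s) * (\<Prod>n\<in>?A. geometric_fps d n)) 1"
    using telescope[of m] fps_eq_upto_one_minus[OF m] by simp
  moreover have "?A \<subseteq> {1..l}"
    using least assms by (fastforce simp: Suc_le_eq)
  moreover have "?A \<subseteq> range (\<lambda>i. s * d ^ i)" by auto
  ultimately show ?thesis by (rule that[rotated 2])
qed

lemma multiplicity_two_odd: "odd n \<Longrightarrow> multiplicity 2 n = 0"
  by (simp add: not_dvd_imp_multiplicity_0)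

lemma multiplicity_two_four_mult_odd:
  assumes "odd n"
  shows "multiplicity 2 (4 * n :: nat) = 2"
proof -
  have "n \<noteq> 0" using assms by (metis even_zero)
  then have "multiplicity 2 (2 * (2 * n)) = 2"
    by (subst multiplicity_times_same, simp, simp, simp)+ (simp add: multiplicity_two_odd[OF assms])
  then show ?thesis by simp
qed

text \<open>
  The three factors are absorbed along \<open>3 ^ i\<close>, \<open>5 * 3 ^ i\<close> and, after
  \<open>(1 - q\<^sup>2) * (1 + q\<^sup>2 + q\<^sup>4 + q\<^sup>6) = (1 - q\<^sup>4) * (1 + q\<^sup>4)\<close>, along \<open>4 * 5 ^ i\<close>.
\<close>

lemma geometric_product_divisible:
  assumes "l \<ge> 2"
  shows "\<exists>g\<in>nat_fps. fps_eq_upto l ((1 - fps_X) * (1 - fps_X ^ 2) * (1 - fps_X ^ 5)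
      * (\<Prod>n=1..l. geometric_fps (3 + multiplicity 2 n) n)) g"
proof -
  let ?G = "\<lambda>n. geometric_fps (3 + multiplicity 2 n) n"
  \<comment> \<open>The ratios match the lengths of the factors: indices in \<open>A\<close> and
    \<open>B\<close> are odd and give 3 terms, indices in \<open>C\<close> are four times an odd
    number and give 5.\<close>
  obtain A where A: "A \<subseteq> {1..l}" "A \<subseteq> range (\<lambda>i. 1 * 3 ^ i)"
    "fps_eq_upto l ((1 - fps_X ^ 1) * (\<Prod>n\<in>A. geometric_fps 3 n)) 1"
    by (rule geometric_chain[of 1 3 l]) auto
  obtain B where B: "B \<subseteq> {1..l}" "B \<subseteq> range (\<lambda>i. 5 * 3 ^ i)"
    "fps_eq_upto l ((1 - fps_X ^ 5) * (\<Prod>n\<in>B. geometric_fps 3 n)) 1"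
    by (rule geometric_chain[of 5 3 l]) auto
  obtain C where C: "C \<subseteq> {1..l}" "C \<subseteq> range (\<lambda>i. 4 * 5 ^ i)"
    "fps_eq_upto l ((1 - fps_X ^ 4) * (\<Prod>n\<in>C. geometric_fps 5 n)) 1"
    by (rule geometric_chain[of 4 5 l]) auto
  have fin: "finite A" "finite B" "finite C" using A B C finite_subset by blast+
  have oddA: "odd n" if "n \<in> A" for n using that A(2) by auto
  have oddB: "odd n" if "n \<in> B" for n using that B(2) by auto
  have fourC: "\<exists>m. odd m \<and> n = 4 * m" if "n \<in> C" for n using that C(2) by auto
  have "A \<inter> B = {}"
  proof -
    have "\<not> 5 dvd (3 :: nat) ^ i" for i
      using prime_dvd_power[of "5 :: nat" 3 i] by auto
    then have "3 ^ i \<noteq> 5 * (3 :: nat) ^ j" for i j by (metis dvd_triv_left)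
    then show ?thesis using A(2) B(2) by fastforce
  qed
  moreover have "(A \<union> B) \<inter> C = {}" using oddA oddB fourC by fastforce
  moreover have "2 \<notin> A \<union> B \<union> C"
  proof
    assume "2 \<in> A \<union> B \<union> C"
    then have "2 \<in> C" using oddA[of 2] oddB[of 2] by auto
    then show False using fourC[of 2] by auto
  qed
  ultimately have split: "prod ?G (insert 2 (A \<union> B \<union> C)) = ?G 2 * (prod ?G A * prod ?G B * prod ?G C)"
    using fin by (simp add: prod.union_disjoint)
  define R where "R = {1..l} - insert 2 (A \<union> B \<union> C)"
  have "insert 2 (A \<union> B \<union> C) \<subseteq> {1..l}"
    using A(1) B(1) C(1) assms by auto
  then have "(\<Prod>n=1..l. ?G n) = prod ?G R * prod ?G (insert 2 (A \<union> B \<union> C))"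
    unfolding R_def by (intro prod.subset_diff) auto
  also note split
  also have "prod ?G A = (\<Prod>n\<in>A. geometric_fps 3 n)"
    using oddA by (intro prod.cong) (auto simp: multiplicity_two_odd)
  also have "prod ?G B = (\<Prod>n\<in>B. geometric_fps 3 n)"
    using oddB by (intro prod.cong) (auto simp: multiplicity_two_odd)
  also have "prod ?G C = (\<Prod>n\<in>C. geometric_fps 5 n)"
    using fourC by (intro prod.cong) (fastforce simp: multiplicity_two_four_mult_odd)+
  finally have "(1 - fps_X) * (1 - fps_X ^ 2) * (1 - fps_X ^ 5) * (\<Prod>n=1..l. ?G n)
     = ((1 - fps_X ^ 1) * (\<Prod>n\<in>A. geometric_fps 3 n)) * ((1 - fps_X ^ 5) * (\<Prod>n\<in>B. geometric_fps 3 n))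
       * ((1 - fps_X ^ 2) * ?G 2) * (\<Prod>n\<in>C. geometric_fps 5 n) * prod ?G R"
    by (simp only: mult_ac power_one_right)
  also have "(1 - fps_X ^ 2) * ?G 2 = (1 - fps_X ^ 4) * (1 + fps_X ^ 4)"
  proof -
    have "(1 - fps_X ^ 2) * ?G 2 = 1 - fps_X ^ 8"
      unfolding one_minus_mult_geometric_fps by simp
    also have "\<dots> = (1 - fps_X ^ 4) * (1 + fps_X ^ 4)"
      by (simp add: algebra_simps flip: power_add)
    finally show ?thesis .
  qed
  also have "((1 - fps_X ^ 1) * (\<Prod>n\<in>A. geometric_fps 3 n)) * ((1 - fps_X ^ 5) * (\<Prod>n\<in>B. geometric_fps 3 n))
       * ((1 - fps_X ^ 4) * (1 + fps_X ^ 4)) * (\<Prod>n\<in>C. geometric_fps 5 n) * prod ?G R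
     = ((1 - fps_X ^ 1) * (\<Prod>n\<in>A. geometric_fps 3 n)) * ((1 - fps_X ^ 5) * (\<Prod>n\<in>B. geometric_fps 3 n))
       * ((1 - fps_X ^ 4) * (\<Prod>n\<in>C. geometric_fps 5 n)) * ((1 + fps_X ^ 4) * prod ?G R)"
    by (simp only: mult_ac)
  also have "fps_eq_upto l \<dots> (1 * 1 * 1 * ((1 + fps_X ^ 4) * prod ?G R))"
    using A(3) B(3) C(3) by (intro fps_eq_upto_mult fps_eq_upto_refl)
  finally show ?thesis
    by (intro bexI) (auto intro!: nat_fps_mult nat_fps_add nat_fps_one nat_fps_X_power nat_fps_prod nat_fps_geometric)
qed

lemma N_double: "n \<noteq> 0 \<Longrightarrow> N (2 * n) = n * (3 + multiplicity 2 n)"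
  by (simp add: N_def multiplicity_times_same add_mult_distrib2)

lemma euler_prod_nonzero: "fps_nth euler_prod 0 \<noteq> 0"
  using euler_prod_eq_upto[of 0 0] by (simp add: fps_eq_upto_def pent_term_def pent_def fps_X_power_iff)

text \<open>By \<open>N_double\<close>, each factor of \<open>even_N_prod\<close> is an Euler factor
  times a geometric polynomial, and the Euler factors cancel.\<close>

lemma even_N_prod_over_euler_prod_eq_upto:
  "fps_eq_upto l (inverse euler_prod * even_N_prod) (\<Prod>n=1..l. geometric_fps (3 + multiplicity 2 n) n)"
proof -
  let ?G = "\<lambda>n. geometric_fps (3 + multiplicity 2 n) n"
  have "fps_eq_upto l even_N_prod (\<Prod>n<l. 1 - fps_X ^ N (2 * Suc n))"
    unfolding even_N_prod_def
  proof (rule prodinf_eq_upto)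
    fix n
    have "N (2 * Suc n) = Suc n * (3 + multiplicity 2 (Suc n))" by (rule N_double) simp
    moreover have "Suc n * 1 \<le> Suc n * (3 + multiplicity 2 (Suc n))" by (intro mult_le_mono2) simp
    ultimately have "Suc n \<le> N (2 * Suc n)" by (metis mult.right_neutral)
    then show "n < N (2 * Suc n)" by (rule Suc_le_lessD)
  qed simp
  also have "(\<Prod>n<l. 1 - fps_X ^ N (2 * Suc n)) = (\<Prod>n<l. (1 - fps_X ^ Suc n) * ?G (Suc n))"
    by (intro prod.cong) (simp_all add: N_double one_minus_mult_geometric_fps del: mult_Suc mult_Suc_right power_Suc)
  also have "\<dots> = (\<Prod>n<l. 1 - fps_X ^ Suc n) * (\<Prod>n=1..l. ?G n)"
    by (simp add: prod.distrib prod.atLeast1_atMost_eq)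
  also have "fps_eq_upto l \<dots> (euler_prod * (\<Prod>n=1..l. ?G n))"
  proof (intro fps_eq_upto_mult fps_eq_upto_refl)
    have "fps_eq_upto l euler_prod (\<Prod>n<l. 1 - fps_X ^ Suc n)"
      unfolding euler_prod_def by (rule prodinf_eq_upto) auto
    then show "fps_eq_upto l (\<Prod>n<l. 1 - fps_X ^ Suc n) euler_prod"
      by (rule fps_eq_upto_sym)
  qed
  finally have "fps_eq_upto l (inverse euler_prod * even_N_prod) (inverse euler_prod * (euler_prod * (\<Prod>n=1..l. ?G n)))"
    by (intro fps_eq_upto_mult fps_eq_upto_refl)
  also have "inverse euler_prod * (euler_prod * (\<Prod>n=1..l. ?G n)) = (\<Prod>n=1..l. ?G n)"
    using inverse_mult_eq_1[OF euler_prod_nonzero] by (simp flip: mult.assoc)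
  finally show ?thesis .
qed

lemma product_side_in_nat_fps:
  "(1 - fps_X) * (1 - fps_X ^ 2) * (1 - fps_X ^ 5) * (inverse euler_prod * even_N_prod) \<in> nat_fps"
proof (rule nat_fpsI_eq_upto)
  fix n :: nat
  let ?D = "(1 - fps_X) * (1 - fps_X ^ 2) * (1 - fps_X ^ 5) :: real fps"
  \<comment> \<open>The degree is raised so that \<open>l \<ge> 2\<close>, because the factor at
    index 2 must occur in the finite product.\<close>
  define l where "l = n + 2"
  obtain g where g: "g \<in> nat_fps"
    "fps_eq_upto l (?D * (\<Prod>n=1..l. geometric_fps (3 + multiplicity 2 n) n)) g"
    using geometric_product_divisible[of l] by (auto simp: l_def)
  have "fps_eq_upto l (?D * (inverse euler_prod * even_N_prod))
     (?D * (\<Prod>n=1..l. geometric_fps (3 + multiplicity 2 n) n))"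
    by (intro fps_eq_upto_mult fps_eq_upto_refl even_N_prod_over_euler_prod_eq_upto)
  also note g(2)
  finally have "fps_eq_upto n (?D * (inverse euler_prod * even_N_prod)) g"
    by (rule fps_eq_upto_mono) (simp add: l_def)
  with g(1) show "\<exists>g\<in>nat_fps. fps_eq_upto n (?D * (inverse euler_prod * even_N_prod)) g"
    by (rule bexI[rotated])
qed

lemma quotient_in_nat_fps: "inverse euler_prod * even_N_prod \<in> nat_fps"
proof (rule nat_fpsI_eq_upto)
  show "\<exists>g\<in>nat_fps. fps_eq_upto l (inverse euler_prod * even_N_prod) g" for l
    using even_N_prod_over_euler_prod_eq_upto[of l]
    by (intro bexI) (auto intro: nat_fps_prod nat_fps_geometric)
qed

section \<open>Combining the tail with the product quotient\<close>

lemma pent_tail_quotient_in_nat_fps: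
  assumes "k \<ge> 1"
  shows "pent_tail k * (inverse euler_prod * even_N_prod) \<in> nat_fps"
proof -
  \<comment> \<open>Multiplying by 1 in the form of \<open>count125_fps_inverse\<close> allows a
    regrouping into two factors that both lie in \<open>nat_fps\<close>.\<close>
  have "pent_tail k * (inverse euler_prod * even_N_prod)
      = pent_tail k * (inverse euler_prod * even_N_prod) * ((1 - fps_X) * (1 - fps_X ^ 2) * (1 - fps_X ^ 5) * count125_fps)"
    by (simp only: count125_fps_inverse mult_1_right)
  also have "\<dots> = (pent_tail k * count125_fps)
      * ((1 - fps_X) * (1 - fps_X ^ 2) * (1 - fps_X ^ 5) * (inverse euler_prod * even_N_prod))"
    by (simp only: mult_ac)
  also have "\<dots> \<in> nat_fps"
    using assms by (intro nat_fps_mult pent_tail_count125_in_nat_fps product_side_in_nat_fps)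
  finally show ?thesis .
qed

theorem mainTheorem2:
  fixes k :: nat
  assumes "k \<ge> 1"
  shows "(-1) ^ k * (1 - 1 / euler_prod * pentagonal_sum (1 - int k) (int k)) * even_N_prod \<in> nat_fps
    \<and> (-1) ^ (k - 1) * (1 - 1 / euler_prod * pentagonal_sum (- int k) (int k)) * even_N_prod \<in> nat_fps"
proof
  have inv: "1 / euler_prod = inverse euler_prod"
    using fps_divide_unit[OF euler_prod_nonzero, of 1] by simp
  have one_minus: "1 - inverse euler_prod * f = inverse euler_prod * (euler_prod - f)" for f
    using inverse_mult_eq_1[OF euler_prod_nonzero] by (simp add: algebra_simps)
  have "(-1) ^ k * (1 - 1 / euler_prod * pentagonal_sum (1 - int k) (int k)) * even_N_prod
      = pent_tail k * (inverse euler_prod * even_N_prod)"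
    unfolding inv one_minus pent_tail_def by (simp only: mult_ac)
  also have "\<dots> \<in> nat_fps" by (rule pent_tail_quotient_in_nat_fps[OF assms])
  finally show "(-1) ^ k * (1 - 1 / euler_prod * pentagonal_sum (1 - int k) (int k)) * even_N_prod \<in> nat_fps" .
  have "(-1) ^ (k - 1) * (euler_prod - pentagonal_sum (- int k) (int k)) = fps_X ^ pent k - pent_tail k"
  proof -
    define s :: "real fps" where "s = (-1) ^ k"
    have "s * s = 1" by (simp add: s_def flip: power_add)
    then have "(- s) * (e - (p + s * x)) = x - s * (e - p)" for e p x
      by (simp add: algebra_simps flip: mult.assoc)
    moreover have "(-1) ^ (k - 1) = - s"
      using assms by (cases k) (auto simp: s_def)
    ultimately show ?thesis
      by (simp only: pentagonal_sum_odd pent_tail_def flip: s_def)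
  qed
  \<comment> \<open>The recursion for the tail cancels \<open>fps_X ^ pent k\<close> and removes the
    minus sign, so the first claim's argument applies at \<open>k + 1\<close>.\<close>
  also have "\<dots> = fps_X ^ (pent k + 2 * k + 1) + pent_tail (Suc k)"
    by (simp add: pent_tail_Suc[of k] pent_term_def)
  finally have "(-1) ^ (k - 1) * (1 - 1 / euler_prod * pentagonal_sum (- int k) (int k)) * even_N_prod
      = (fps_X ^ (pent k + 2 * k + 1) + pent_tail (Suc k)) * (inverse euler_prod * even_N_prod)"
    unfolding inv one_minus by (simp only: mult_ac)
  also have "\<dots> = fps_X ^ (pent k + 2 * k + 1) * (inverse euler_prod * even_N_prod)
      + pent_tail (Suc k) * (inverse euler_prod * even_N_prod)"
    by (rule distrib_right)
  also have "\<dots> \<in> nat_fps"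
    by (intro nat_fps_add nat_fps_mult nat_fps_X_power quotient_in_nat_fps pent_tail_quotient_in_nat_fps) simp
  finally show "(-1) ^ (k - 1) * (1 - 1 / euler_prod * pentagonal_sum (- int k) (int k)) * even_N_prod \<in> nat_fps" .
qed

end
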